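(* Let $1\le p<2$ and $p<r\le\infty$, and let $p'$ be the exponent conjugate to $p$ ($p'=\infty$ if $p=1$). Then there exists a constant $C_{p,r}<\infty$, depending only on $p$ and $r$, such that for every $F\in\ell^p(\mathbb{Z},\mathcal{D})$, $$\|\mathcal{V}_r(\sigma(F))\|_{L^{p'}(\mathbb{T})}\le C_{p,r}\|F\|_{\ell^p(\mathbb{Z})}.$$
   Context: $\mathcal{D}$ is the open unit disc in $\mathbb{C}$ and $\mathbb{T}$ is the unit circle, with Lebesgue measure normalized to total mass 1. $\ell^p(\mathbb{Z},\mathcal{D})$ is the set of sequences $F=(F_n)_{n\in\mathbb{Z}}$ in $\ell^p(\mathbb{Z})$ with $F_n\in\mathcal{D}$ for all $n$. $\|\cdot\|_{\mathrm{op}}$ is the operator norm of $2\times 2$ matrices acting on the Hilbert space $\mathbb{C}^2$. For $N\in\mathbb{Z}$ and $z\in\mathbb{T}$, the truncated linear Fourier transform is $$\sigma_N(z)=\sigma(F)(N;z)=\sum_{n=-\infty}^N\begin{pmatrix}0&F_nz^n\\ \overline{F_n}z^{-n}&0\end{pmatrix};$$ only the differences $\sigma_N(z)-\sigma_M(z)$, $M<N$, are used below, and these are the finite sums over $M<n\le N$ (this is the meaning given to them when $F$ is not finitely supported). For $1\le r<\infty$, the $r$-variation is $$\mathcal{V}_r(\sigma(F))(z)=\sup_K\sup_{N_0<\dots<N_K}\Big(\sum_{j=0}^{K-1}\|\sigma_{N_{j+1}}(z)-\sigma_{N_j}(z)\|_{\mathrm{op}}^r\Big)^{1/r},$$ the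 suprema being over all integers $K\ge1$ and all strictly increasing finite sequences of integers $N_0<\dots<N_K$; for $r=\infty$ the $\ell^r$ sum is replaced by a maximum, i.e. $\mathcal{V}_\infty(\sigma(F))(z)=\sup_{M<N}\|\sigma_N(z)-\sigma_M(z)\|_{\mathrm{op}}$. *)

theory Defs
  imports "HOL-Probability.Essential_Supremum"
begin

text \<open>Only exponents \<open>a > 0\<close> occur below, so that \<open>0\<close> and \<open>\<infinity>\<close> are fixed.\<close>

definition epowr :: "ennreal \<Rightarrow> real \<Rightarrow> ennreal" where
  "epowr x a = (if x = \<infinity> then \<infinity> else ennreal (enn2real x powr a))"

text \<open>
  The \<open>L\<^sup>q\<close> norm of a nonnegative function, for \<open>1 \<le> q \<le> \<infinity>\<close>.  As for \<open>esssup\<close>, the value is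
  \<open>\<infinity>\<close> on functions that are not measurable (\<open>nn_integral\<close> alone would be a lower integral there),
  so a finite bound on the norm includes measurability.
\<close>

definition Lq_norm :: "ennreal \<Rightarrow> 'a measure \<Rightarrow> ('a \<Rightarrow> ennreal) \<Rightarrow> ennreal" where
  "Lq_norm q M f =
     (if f \<notin> borel_measurable M then \<infinity>
      else if q = \<infinity> then esssup M f
      else epowr (\<integral>\<^sup>+ x. epowr (f x) (enn2real q) \<partial>M) (1 / enn2real q))"

definition lp_norm :: "ennreal \<Rightarrow> (int \<Rightarrow> complex) \<Rightarrow> ennreal" where
  "lp_norm p F = Lq_norm p (count_space UNIV) (\<lambda>n. ennreal (norm (F n)))"

definition lp_disc :: "ennreal \<Rightarrow> (int \<Rightarrow> complex) set" where
  "lp_disc p = {F. lp_norm p F < \<infinity> \<and> (\<forall>n. F n \<in> ball 0 1)}"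

definition circle_measure :: "complex measure" where
  "circle_measure =
     distr (restrict_space lborel {0..<1}) (restrict_space borel (sphere 0 1))
       (\<lambda>t::real. cis (2 * pi * t))"

lemma space_circle_measure: "space circle_measure = sphere 0 1"
  by (simp add: circle_measure_def space_restrict_space)

lemma emeasure_circle_measure_space: "emeasure circle_measure (sphere 0 1) = 1"
proof -
  have cis: "(\<lambda>t::real. cis (2 * pi * t)) \<in>
      measurable (restrict_space lborel {0..<1}) (restrict_space borel (sphere 0 1))"
    by (intro measurable_restrict_space2 measurable_restrict_space1)
       (auto simp: measurable_lborel1 intro!: borel_measurable_continuous_onI continuous_intros)
  have S: "sphere 0 1 \<in> sets (restrict_space borel (sphere (0::complex) 1))"
    by (metis sets.top space_borel space_restrict_space Int_UNIV_right)
  have "(\<lambda>t::real. cis (2 * pi * t)) -` sphere 0 1 \<inter> space (restrict_space lborel {0..<1}) = {0..<1}"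
    by (auto simp: space_restrict_space)
  then show ?thesis
    unfolding circle_measure_def emeasure_distr[OF cis S]
    by (simp add: emeasure_restrict_space)
qed

definition fourier_matrix :: "(int \<Rightarrow> complex) \<Rightarrow> int \<Rightarrow> complex \<Rightarrow> complex^2^2" where
  "fourier_matrix F n z =
     vector [vector [0, F n * z powi n],
             vector [cnj (F n) * z powi (- n), 0]]"

text \<open>
  The difference \<open>\<sigma>\<^sub>N(z) - \<sigma>\<^sub>M(z)\<close> for \<open>M < N\<close>.  It is a finite sum for every \<open>F\<close>, whereas
  the sum over all \<open>n \<le> N\<close> that gives \<open>\<sigma>\<^sub>N(z)\<close> itself need not converge.
\<close>

definition sigma_diff :: "(int \<Rightarrow> complex) \<Rightarrow> int \<Rightarrow> int \<Rightarrow> complex \<Rightarrow> complex^2^2" where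
  "sigma_diff F M N z = (\<Sum>n\<in>{M<..N}. fourier_matrix F n z)"

definition op_norm :: "complex^2^2 \<Rightarrow> real" where
  "op_norm A = onorm (\<lambda>v. A *v v)"

text \<open>A sequence \<open>N\<^sub>0 < \<dots> < N\<^sub>K\<close> is given by a function, of which only the values on \<open>{..K}\<close> matter.\<close>

definition variation :: "ennreal \<Rightarrow> (int \<Rightarrow> complex) \<Rightarrow> complex \<Rightarrow> ennreal" where
  "variation r F z =
     (if r = \<infinity> then
        (SUP (M, N) \<in> {(M, N). M < N}. ennreal (op_norm (sigma_diff F M N z)))
      else
        (SUP K \<in> {1..}. SUP N \<in> {N :: nat \<Rightarrow> int. strict_mono_on {..K} N}.
           ennreal ((\<Sum>j<K. op_norm (sigma_diff F (N j) (N (Suc j)) z) powr enn2real r)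
                      powr (1 / enn2real r))))"

end

theory Submission
  imports Defs
begin

text \<open>
  On the unit circle \<open>\<sigma>\<^sub>N(z) - \<sigma>\<^sub>M(z)\<close> is an antidiagonal matrix whose two entries are complex
  conjugates of each other, so its operator norm is the modulus of the exponential sum
  \<open>\<Sum>\<^bsub>M < n \<le> N\<^esub> F\<^sub>n z\<^sup>n\<close>.  The theorem is therefore a variational Hausdorff--Young inequality for
  scalar Fourier series.  For \<open>p = 1\<close> it is the triangle inequality (\<open>variation_le_l1_norm\<close>).
  Now let \<open>1 < p < 2\<close>, and write \<open>q\<close> for the conjugate exponent.  As \<open>\<V>\<^sub>r\<close> decreases in \<open>r\<close>, one
  may take \<open>p < r \<le> 2 < q\<close>.

  The Hausdorff--Young inequality itself (\<open>hausdorff_young_trig_poly\<close>) follows by Marcinkiewicz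
  interpolation between Parseval's identity and the trivial bound of the sup norm by the
  \<open>\<ell>\<^sup>1\<close> norm: at each level \<open>l\<close> of the transform, the large coefficients are discarded, since
  together they contribute at most \<open>l / 2\<close>.

  The step to maximal functions and variations is a halving argument in the manner of Christ and
  Kiselev.  Give the frequency \<open>n\<close> the mass \<open>\<bar>a\<^sub>n\<bar>\<^sup>p\<close>.  Every interval of frequencies splits into a
  left part, a single frequency and a right part, where each of the two parts has at most half
  of the mass (\<open>ex_halving_index\<close>).  A quantity \<open>U\<close> of intervals that satisfies
  \<open>U(whole) \<le> \<theta> (U(left) + U(right)) + B mass\<^sup>s\<close> for all splittings is therefore \<open>O(mass\<^sup>s)\<close> as soon
  as \<open>2 \<theta> (1/2)\<^sup>s < 1\<close> (\<open>splitting_recursion_bound\<close>).  This applies twice with \<open>s = q / p\<close>.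
  The \<open>q\<close>th moment of the largest initial partial sum has \<open>\<theta>\<close> arbitrarily close to \<open>1\<close>, and
  \<open>s > 1\<close>; the error term comes from Hausdorff--Young (\<open>maximal_hausdorff_young\<close>).  The \<open>q\<close>th
  moment of the \<open>r\<close>-variation has \<open>\<theta>\<close> arbitrarily close to \<open>2\<close> to the power \<open>q / r - 1\<close>, and the
  condition becomes \<open>q / r < q / p\<close>, that is, \<open>p < r\<close>; at most one step of a partition crosses
  from left to right, and the error that it causes is controlled by the maximal function
  (\<open>variational_hausdorff_young\<close>).

  These bounds concern finitely many frequencies and are uniform in their number.  The windows
  from \<open>1 - L\<close> to \<open>L\<close> exhaust the integers, and Fatou's lemma concludes
  (\<open>variation_powr_le_liminf\<close>, \<open>variation_Lq_norm_le\<close>).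
\<close>

section \<open>Elementary inequalities for real powers\<close>

text \<open>
  A substitute for Minkowski's inequality in which one of the two constants can be brought
  arbitrarily close to 1: whichever of \<open>b \<le> \<delta> a\<close> and \<open>a \<le> b / \<delta>\<close> holds, one summand absorbs the other.
\<close>

lemma powr_add_le_epsilon:
  fixes a b t \<delta> :: real
  assumes "0 \<le> a" "0 \<le> b" "0 \<le> t" "0 < \<delta>"
  shows "(a + b) powr t \<le> (1 + \<delta>) powr t * a powr t + (1 + 1 / \<delta>) powr t * b powr t"
proof (cases "b \<le> \<delta> * a")
  case True
  then have "(a + b) powr t \<le> ((1 + \<delta>) * a) powr t"
    using assms by (intro powr_mono2) (auto simp: algebra_simps)
  then show ?thesis
    using assms by (simp add: powr_mult add_increasing2)
next
  case False
  then have "a + b \<le> (1 + 1 / \<delta>) * b"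
    using assms by (simp add: field_simps)
  then have "(a + b) powr t \<le> ((1 + 1 / \<delta>) * b) powr t"
    using assms by (intro powr_mono2) auto
  then show ?thesis
    using assms by (simp add: powr_mult add_increasing)
qed

lemma powr_add_le_two_powr:
  fixes a b t :: real
  assumes "0 \<le> a" "0 \<le> b" "1 \<le> t"
  shows "(a + b) powr t \<le> 2 powr (t - 1) * (a powr t + b powr t)"
proof (cases "a = 0 \<or> b = 0")
  case True
  have "1 \<le> (2::real) powr (t - 1)"
    using assms by (intro ge_one_powr_ge_zero) auto
  then show ?thesis
    using True assms mult_right_mono[of 1 "2 powr (t-1)" "a powr t"] mult_right_mono[of 1 "2 powr (t-1)" "b powr t"]
    by auto
next
  case False
  then have mid: "2 * ((a + b) / 2) powr t \<le> a powr t + b powr t"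
    using assms convex_onD[OF powr_convex[of t], of "1/2" a b] by (simp add: field_simps)
  have "(a + b) powr t = 2 powr (t - 1) * (2 * ((a + b) / 2) powr t)"
    by (simp add: powr_divide powr_diff)
  also have "\<dots> \<le> 2 powr (t - 1) * (a powr t + b powr t)"
    by (intro mult_left_mono mid) auto
  finally show ?thesis .
qed

lemma ex_powr_mult_less_one:
  fixes c t :: real
  assumes "c < 1"
  obtains \<delta> where "0 < \<delta>" "(1 + \<delta>) powr t * c < 1"
proof -
  have "((\<lambda>\<delta>. (1 + \<delta>) powr t * c) \<longlongrightarrow> (1 + 0) powr t * c) (at_right 0)"
    by (intro tendsto_intros) auto
  then have "\<forall>\<^sub>F \<delta> in at_right 0. (1 + \<delta>) powr t * c < 1"
    using assms by (intro order_tendstoD(2)) auto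
  moreover have "\<forall>\<^sub>F \<delta>::real in at_right 0. 0 < \<delta>"
    by (rule eventually_at_right_less)
  ultimately have "\<forall>\<^sub>F \<delta>::real in at_right 0. 0 < \<delta> \<and> (1 + \<delta>) powr t * c < 1"
    by eventually_elim auto
  then show ?thesis
    using that eventually_happens'[OF trivial_limit_at_right_real] by blast
qed

text \<open>
  The \<open>\<ell>\<^sup>r\<close> norm decreases in \<open>r\<close>: with \<open>w = \<Sum>\<^sub>j x\<^sub>j\<^sup>s\<close>, each factor \<open>x\<^sub>j\<close> is at most \<open>w\<close> to the power
  \<open>1 / s\<close>, which bounds the excess \<open>x\<^sub>j\<close> to the power \<open>r - s\<close>.
\<close>

lemma powr_sum_le_powr_of_smaller_exponent:
  fixes x :: "'a \<Rightarrow> real"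
  assumes "finite A" "\<And>j. j \<in> A \<Longrightarrow> 0 \<le> x j" "0 < s" "s \<le> r"
  shows "(\<Sum>j\<in>A. x j powr r) powr (1 / r) \<le> (\<Sum>j\<in>A. x j powr s) powr (1 / s)"
proof -
  define w where "w = (\<Sum>j\<in>A. x j powr s)"
  have w: "0 \<le> w" by (simp add: w_def sum_nonneg)
  have le: "x j powr s \<le> w" if "j \<in> A" for j
    unfolding w_def using assms that by (intro member_le_sum) auto
  have "x j powr r \<le> x j powr s * w powr ((r - s) / s)" if "j \<in> A" for j
  proof -
    have "x j powr r = x j powr s * (x j powr s) powr ((r - s) / s)"
      using assms by (simp add: powr_powr flip: powr_add)
    also have "\<dots> \<le> x j powr s * w powr ((r - s) / s)"
      using assms le[OF that] by (intro mult_left_mono powr_mono2) auto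
    finally show ?thesis .
  qed
  then have "(\<Sum>j\<in>A. x j powr r) \<le> w * w powr ((r - s) / s)"
    unfolding w_def by (simp add: sum_distrib_right sum_mono)
  also have "\<dots> = w powr (r / s)"
    using w assms by (cases "w = 0") (auto simp: powr_mult_base diff_divide_distrib)
  finally have "(\<Sum>j\<in>A. x j powr r) powr (1 / r) \<le> (w powr (r / s)) powr (1 / r)"
    using assms by (intro powr_mono2 sum_nonneg) auto
  also have "\<dots> = w powr (1 / s)"
    using assms by (simp add: powr_powr)
  finally show ?thesis by (simp add: w_def)
qed

section \<open>Recursion by halving the mass\<close>

text \<open>
  The least \<open>k\<close> for which the mass up to and including \<open>k\<close> reaches half of the total.  The point \<open>k\<close>
  itself may carry any amount of mass, which is why it belongs to neither part.
\<close>

lemma ex_halving_index: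
  fixes m :: "nat \<Rightarrow> real"
  assumes "\<And>n. 0 \<le> m n" "x < y"
  obtains k where "x \<le> k" "k < y"
    "sum m {x..<k} \<le> sum m {x..<y} / 2" "sum m {Suc k..<y} \<le> sum m {x..<y} / 2"
proof -
  define P where "P k \<longleftrightarrow> x \<le> k \<and> k < y \<and> sum m {x..<y} / 2 \<le> sum m {x..<Suc k}" for k
  have S: "0 \<le> sum m {x..<y}" using assms by (simp add: sum_nonneg)
  have "P (y - 1)" using assms S by (auto simp: P_def)
  then obtain k where k: "P k" and least: "\<And>j. j < k \<Longrightarrow> \<not> P j"
    using exists_least_iff[of P] by blast
  have "sum m {x..<k} \<le> sum m {x..<y} / 2"
  proof (cases "k = x")
    case False
    then have "\<not> P (k - 1)" using least[of "k - 1"] k by (auto simp: P_def)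
    moreover have "0 < k" using False k by (auto simp: P_def)
    ultimately show ?thesis using False k by (auto simp: P_def simp del: sum.op_ivl_Suc)
  qed (use S in simp)
  moreover have "sum m {x..<Suc k} + sum m {Suc k..<y} = sum m {x..<y}"
    using k by (intro sum.atLeastLessThan_concat) (auto simp: P_def)
  then have "sum m {Suc k..<y} \<le> sum m {x..<y} / 2"
    using k by (auto simp: P_def)
  ultimately show ?thesis using that k by (auto simp: P_def)
qed

text \<open>
  Induction on the length of the interval.  If both halves obey the bound with constant \<open>A\<close>,
  then the whole obeys it with constant \<open>\<theta> 2\<^bsup>1 - s\<^esup> A + B\<close>, and the asserted \<open>A\<close> is the fixed point of
  this map.
\<close>

lemma splitting_recursion_bound:
  fixes U :: "nat \<Rightarrow> nat \<Rightarrow> ennreal" and m :: "nat \<Rightarrow> real" and \<theta> B s :: real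
  assumes m: "\<And>n. 0 \<le> m n" and empty: "\<And>x. U x x = 0"
    and const: "0 \<le> \<theta>" "0 \<le> B" "0 \<le> s" "\<theta> * 2 powr (1 - s) < 1"
    and rec: "\<And>x k y. x \<le> k \<Longrightarrow> k < y \<Longrightarrow>
       U x y \<le> ennreal \<theta> * (U x k + U (Suc k) y) + ennreal (B * sum m {x..<y} powr s)"
    and "x \<le> y"
  shows "U x y \<le> ennreal (B / (1 - \<theta> * 2 powr (1 - s)) * sum m {x..<y} powr s)"
  using \<open>x \<le> y\<close>
proof (induction "y - x" arbitrary: x y rule: less_induct)
  case less
  define A where "A = B / (1 - \<theta> * 2 powr (1 - s))"
  have A: "0 \<le> A" using const by (simp add: A_def)
  have A_eq: "\<theta> * 2 powr (1 - s) * A + B = A"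
    using const by (simp add: A_def field_simps)
  show ?case
  proof (cases "x = y")
    case True
    then show ?thesis by (simp add: empty)
  next
    case False
    define S where "S = sum m {x..<y}"
    have S: "0 \<le> S" using m by (simp add: S_def sum_nonneg)
    obtain k where k: "x \<le> k" "k < y" "sum m {x..<k} \<le> S / 2" "sum m {Suc k..<y} \<le> S / 2"
      using ex_halving_index[of m x y] m False less.prems unfolding S_def by auto
    have half: "U i j \<le> ennreal (A * (S / 2) powr s)"
      if "j - i < y - x" "i \<le> j" "sum m {i..<j} \<le> S / 2" for i j
    proof -
      have "U i j \<le> ennreal (A * sum m {i..<j} powr s)"
        using less.hyps[of j i] that by (simp add: A_def)
      also have "\<dots> \<le> ennreal (A * (S / 2) powr s)"
        using A const that m by (intro ennreal_leI mult_left_mono powr_mono2 sum_nonneg) auto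
      finally show ?thesis .
    qed
    have "U x y \<le> ennreal \<theta> * (U x k + U (Suc k) y) + ennreal (B * S powr s)"
      unfolding S_def using k by (intro rec) auto
    also have "\<dots> \<le> ennreal \<theta> * (ennreal (A * (S / 2) powr s) + ennreal (A * (S / 2) powr s))
        + ennreal (B * S powr s)"
      using k by (intro add_mono mult_left_mono half) auto
    also have "\<dots> = ennreal (\<theta> * (2 * (A * (S / 2) powr s)) + B * S powr s)"
      using A const by (simp flip: ennreal_plus ennreal_mult)
    also have "\<theta> * (2 * (A * (S / 2) powr s)) + B * S powr s = (\<theta> * 2 powr (1 - s) * A + B) * S powr s"
      by (simp add: powr_divide powr_diff algebra_simps)
    finally show ?thesis unfolding A_eq unfolding S_def A_def .
  qed
qed

section \<open>Integration on the circle and Parseval's identity\<close>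

lemma sigma_finite_circle_measure: "sigma_finite_measure circle_measure"
  by (intro finite_measure.axioms(1) finite_measureI)
     (simp add: space_circle_measure emeasure_circle_measure_space)

lemma borel_measurable_circle_measureI:
  assumes "f \<in> borel_measurable borel"
  shows "f \<in> borel_measurable circle_measure"
  using measurable_restrict_space1[OF assms, of "sphere 0 1"]
  by (simp add: circle_measure_def cong: measurable_cong_sets)

lemma nn_integral_circle_measure:
  assumes "f \<in> borel_measurable circle_measure"
  shows "(\<integral>\<^sup>+ z. f z \<partial>circle_measure) = (\<integral>\<^sup>+ t. indicator {0..<1} t * f (cis (2 * pi * t)) \<partial>lborel)"
proof -
  have cis: "(\<lambda>t::real. cis (2 * pi * t)) \<in>
      measurable (restrict_space lborel {0..<1}) (restrict_space borel (sphere 0 1))"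
    by (intro measurable_restrict_space2 measurable_restrict_space1)
       (auto simp: measurable_lborel1 intro!: borel_measurable_continuous_onI continuous_intros)
  show ?thesis
    using nn_integral_distr[OF cis assms[unfolded circle_measure_def]]
    by (simp add: circle_measure_def nn_integral_restrict_space mult.commute)
qed

lemma has_integral_cis_int:
  fixes k :: int
  shows "((\<lambda>t. cis (2 * pi * (of_int k * t))) has_integral (if k = 0 then 1 else 0)) {0..1}"
proof (cases "k = 0")
  case True
  then show ?thesis
    using has_integral_const_real[of "1::complex" 0 1] by simp
next
  case False
  define c where "c = 2 * pi * \<i> * of_int k"
  have c: "c \<noteq> 0" using False by (simp add: c_def)
  have "((\<lambda>t. exp (c * of_real t)) has_integral (exp (c * of_real 1) / c - exp (c * of_real 0) / c)) {0..1}"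
    by (rule fundamental_theorem_of_calculus)
       (use c in \<open>auto intro!: derivative_eq_intros has_vector_derivative_real_field
          simp: has_real_derivative_iff_has_vector_derivative[symmetric]\<close>)
  moreover have "exp c = 1"
    using exp_integer_2pi[of "of_int k"] by (simp add: c_def mult_ac)
  moreover have "exp (c * of_real t) = cis (2 * pi * (of_int k * t))" for t
    by (simp add: cis_conv_exp c_def mult_ac)
  ultimately show ?thesis using False by simp
qed

lemma nn_integral_trig_poly_norm_sq:
  fixes c :: "nat \<Rightarrow> complex"
  assumes "finite A"
  shows "(\<integral>\<^sup>+ z. ennreal ((norm (\<Sum>n\<in>A. c n * z ^ n))\<^sup>2) \<partial>circle_measure) = ennreal (\<Sum>n\<in>A. (norm (c n))\<^sup>2)"
proof -
  define f where "f t = (norm (\<Sum>n\<in>A. c n * cis (2 * pi * t) ^ n))\<^sup>2" for t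
  have expand: "complex_of_real (f t) =
      (\<Sum>m\<in>A. \<Sum>n\<in>A. (c m * cnj (c n)) * cis (2 * pi * (of_int (int m - int n) * t)))" for t
  proof -
    have *: "cis (2 * pi * t) ^ m * cis (- (2 * pi * t)) ^ n = cis (2 * pi * (of_int (int m - int n) * t))" for m n
      by (simp add: Complex.DeMoivre cis_mult algebra_simps)
    have "complex_of_real (f t) =
        (\<Sum>m\<in>A. c m * cis (2 * pi * t) ^ m) * cnj (\<Sum>n\<in>A. c n * cis (2 * pi * t) ^ n)"
      unfolding f_def using complex_norm_square by (simp only: of_real_power)
    also have "\<dots> = (\<Sum>m\<in>A. \<Sum>n\<in>A. (c m * cnj (c n)) * (cis (2 * pi * t) ^ m * cis (- (2 * pi * t)) ^ n))"
      by (simp add: sum_product cis_cnj mult_ac)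
    finally show ?thesis unfolding * .
  qed
  have "((\<lambda>t. complex_of_real (f t)) has_integral
      (\<Sum>m\<in>A. \<Sum>n\<in>A. (c m * cnj (c n)) * (if int m - int n = 0 then 1 else 0))) {0..1}"
    unfolding expand
    by (intro has_integral_sum has_integral_mult_right assms has_integral_cis_int)
  moreover have "(\<Sum>m\<in>A. \<Sum>n\<in>A. (c m * cnj (c n)) * (if int m - int n = 0 then 1 else 0)) =
      complex_of_real (\<Sum>n\<in>A. (norm (c n))\<^sup>2)"
    using assms by (simp add: complex_norm_square if_distrib[of "(*) _"] del: of_real_power cong: if_cong)
  ultimately have "((\<lambda>t. complex_of_real (f t)) has_integral
      complex_of_real (\<Sum>n\<in>A. (norm (c n))\<^sup>2)) {0..1}"
    by simp
  from has_integral_linear[OF this bounded_linear_Re]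
  have "(f has_integral (\<Sum>n\<in>A. (norm (c n))\<^sup>2)) {0..1}"
    by (simp add: o_def)
  then have "(f has_integral (\<Sum>n\<in>A. (norm (c n))\<^sup>2)) {0..<1}"
    by (subst has_integral_spike_set_eq[where T = "{0..1}"])
       (assumption | rule negligible_subset[of "{1}"], force, force)+
  then have "(\<integral>\<^sup>+ t. indicator {0..<1} t * f t \<partial>lborel) = ennreal (\<Sum>n\<in>A. (norm (c n))\<^sup>2)"
    by (rule nn_integral_has_integral_lebesgue[rotated]) (simp add: f_def)
  moreover have "(\<lambda>z. ennreal ((norm (\<Sum>n\<in>A. c n * z ^ n))\<^sup>2)) \<in> borel_measurable circle_measure"
    by (intro borel_measurable_circle_measureI) measurable
  ultimately show ?thesis
    by (simp add: nn_integral_circle_measure f_def ennreal_indicator ennreal_mult)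
qed

section \<open>The Hausdorff--Young inequality\<close>

lemma nn_integral_powr_from_0:
  fixes a b :: real
  assumes "-1 < a" "0 \<le> b" "0 \<le> c"
  shows "(\<integral>\<^sup>+ l. indicator {0..b} l * ennreal (c * l powr a) \<partial>lborel) = ennreal (c * (b powr (a + 1) / (a + 1)))"
  using nn_integral_has_integral_lebesgue[OF _ has_integral_mult_right[OF has_integral_powr_from_0[OF assms(1,2)], of c]]
    assms(3)
  by (simp add: ennreal_mult ennreal_indicator)

lemma conjugate_exponent:
  fixes p q :: real
  assumes "1 < p" "p < 2" "1 / p + 1 / q = 1"
  shows "q = p / (p - 1)" "2 < q" "q / p = q - 1" "1 < q / p"
proof -
  have "q \<noteq> 0" using assms by auto
  then show q: "q = p / (p - 1)"
    using assms by (simp add: field_simps)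
  show "2 < q" "q / p = q - 1" "1 < q / p"
    using assms(1,2) by (simp_all add: q field_simps)
qed

text \<open>
  Marcinkiewicz interpolation, with \<open>\<mu> = \<Sum>\<^sub>n \<bar>a\<^sub>n\<bar>\<^sup>p\<close>.  The layer cake formula writes \<open>f\<^sup>q\<close> as an integral
  over levels \<open>0 < l \<le> f\<close>.  At level \<open>l\<close> only coefficients with \<open>l \<bar>a\<^sub>n\<bar>\<^bsup>p - 1\<^esup> \<le> 2 \<mu>\<close> are kept; the others sum to at
  most \<open>l / 2\<close>, so the truncated sum \<open>G\<close> still satisfies \<open>l \<le> 2 G\<close>, and the integrand can be
  bounded with \<open>G\<^sup>2\<close> and evaluated by Parseval.  After exchanging the integrals, the level
  integral for the frequency \<open>n\<close> runs up to \<open>2 \<mu> \<bar>a\<^sub>n\<bar>\<^bsup>1 - p\<^esup>\<close>, converges at \<open>0\<close> because \<open>q > 2\<close>, and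
  returns a multiple of \<open>\<bar>a\<^sub>n\<bar>\<^sup>p\<close> because \<open>(p - 1) (q - 2) = 2 - p\<close>.
\<close>

lemma hausdorff_young_trig_poly:
  fixes p q :: real and a :: "nat \<Rightarrow> complex"
  assumes p: "1 < p" "p < 2" and pq: "1 / p + 1 / q = 1" and A: "finite A"
  shows "(\<integral>\<^sup>+ z. ennreal (norm (\<Sum>n\<in>A. a n * z ^ n) powr q) \<partial>circle_measure)
     \<le> ennreal (q * 2 powr q / (q - 2) * (\<Sum>n\<in>A. norm (a n) powr p) powr (q / p))"
proof -
  note q = conjugate_exponent(1)[OF p pq] and q2 = conjugate_exponent(2)[OF p pq]
    and qp = conjugate_exponent(3)[OF p pq]
  have qp2: "(p - 1) * (q - 2) = 2 - p"
    using p by (simp add: q field_simps)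
  define \<mu> where "\<mu> = (\<Sum>n\<in>A. norm (a n) powr p)"
  define f where "f z = norm (\<Sum>n\<in>A. a n * z ^ n)" for z
  show ?thesis
  proof (cases "\<mu> = 0")
    case True
    then have "\<forall>n\<in>A. a n = 0"
      using A by (simp add: \<mu>_def sum_nonneg_eq_0_iff)
    then show ?thesis by simp
  next
    case False
    then have \<mu>: "0 < \<mu>"
      by (simp add: \<mu>_def sum_nonneg less_le)
    define c where "c l n = (if l * norm (a n) powr (p - 1) \<le> 2 * \<mu> then a n else 0)" for l n
    define G where "G l z = norm (\<Sum>n\<in>A. c l n * z ^ n)" for l z
    define h where "h l z = indicator {0..} l * ennreal (4 * q * l powr (q - 3) * (G l z)\<^sup>2)" for l z
    \<comment> \<open>A discarded coefficient satisfies \<open>\<bar>a\<^sub>n\<bar> \<le> l / (2 \<mu>) \<bar>a\<^sub>n\<bar>\<^sup>p\<close>; these bounds add up to \<open>l / 2\<close>.\<close>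
    have G_large: "l \<le> 2 * G l z" if z: "norm z = 1" and l: "0 < l" "l \<le> f z" for l z
    proof -
      have "f z \<le> norm (\<Sum>n\<in>A. c l n * z ^ n) + norm (\<Sum>n\<in>A. (a n - c l n) * z ^ n)"
        unfolding f_def by (rule order_trans[OF _ norm_triangle_ineq])
          (simp add: sum.distrib[symmetric] algebra_simps)
      moreover have "norm (\<Sum>n\<in>A. (a n - c l n) * z ^ n) \<le> (\<Sum>n\<in>A. l / (2 * \<mu>) * norm (a n) powr p)"
      proof (intro sum_norm_le)
        fix n assume "n \<in> A"
        have "norm (a n) \<le> l / (2 * \<mu>) * norm (a n) powr p" if "2 * \<mu> < l * norm (a n) powr (p - 1)"
        proof -
          have "norm (a n) * (2 * \<mu>) \<le> norm (a n) * (l * norm (a n) powr (p - 1))"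
            using that by (intro mult_left_mono) auto
          also have "\<dots> = l * norm (a n) powr p"
            by (simp add: powr_mult_base)
          finally show ?thesis using \<mu> by (simp add: field_simps)
        qed
        then show "norm ((a n - c l n) * z ^ n) \<le> l / (2 * \<mu>) * norm (a n) powr p"
          using z l \<mu> by (auto simp: c_def norm_mult norm_power)
      qed
      moreover have "(\<Sum>n\<in>A. l / (2 * \<mu>) * norm (a n) powr p) = l / 2"
        unfolding sum_distrib_left[symmetric] \<mu>_def[symmetric] using \<mu> by simp
      ultimately show ?thesis using l by (simp add: G_def)
    qed
    have pointwise: "ennreal (f z powr q) \<le> (\<integral>\<^sup>+ l. h l z \<partial>lborel)" if z: "norm z = 1" for z
    proof -
      have f0: "0 \<le> f z" by (simp add: f_def)
      have "ennreal (f z powr q) = (\<integral>\<^sup>+ l. indicator {0..f z} l * ennreal (q * l powr (q - 1)) \<partial>lborel)"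
        using q2 f0 by (subst nn_integral_powr_from_0) auto
      also have "\<dots> \<le> (\<integral>\<^sup>+ l. h l z \<partial>lborel)"
      proof (intro nn_integral_mono)
        fix l :: real
        have "q * l powr (q - 1) \<le> 4 * q * l powr (q - 3) * (G l z)\<^sup>2" if l: "0 < l" "l \<le> f z"
        proof -
          have "l powr (q - 1) = l powr (q - 3) * l\<^sup>2"
            using l by (simp flip: powr_numeral powr_add)
          also have "\<dots> \<le> l powr (q - 3) * (2 * G l z)\<^sup>2"
            using G_large[OF z l] l by (intro mult_left_mono power_mono) auto
          finally show ?thesis using q2 by (simp add: power_mult_distrib)
        qed
        then show "indicator {0..f z} l * ennreal (q * l powr (q - 1)) \<le> h l z"
          unfolding h_def by (cases "l = 0") (auto simp: indicator_def intro!: ennreal_leI)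
      qed
      finally show ?thesis .
    qed
    have level: "(\<integral>\<^sup>+ z. h l z \<partial>circle_measure)
        = (\<Sum>n\<in>A. indicator {0..} l * ennreal (4 * q * l powr (q - 3) * (norm (c l n))\<^sup>2))" for l
    proof -
      have [measurable]: "(\<lambda>z. ennreal ((G l z)\<^sup>2)) \<in> borel_measurable circle_measure"
        unfolding G_def by (intro borel_measurable_circle_measureI) measurable
      have "(\<integral>\<^sup>+ z. h l z \<partial>circle_measure) =
          (\<integral>\<^sup>+ z. (indicator {0..} l * ennreal (4 * q * l powr (q - 3))) * ennreal ((G l z)\<^sup>2) \<partial>circle_measure)"
        using q2 by (simp add: h_def ennreal_mult mult.assoc)
      also have "\<dots> = (indicator {0..} l * ennreal (4 * q * l powr (q - 3))) * ennreal (\<Sum>n\<in>A. (norm (c l n))\<^sup>2)"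
        using nn_integral_trig_poly_norm_sq[OF A, of "c l"]
        by (subst nn_integral_cmult) (measurable, simp add: G_def)
      also have "\<dots> = (\<Sum>n\<in>A. indicator {0..} l * ennreal (4 * q * l powr (q - 3) * (norm (c l n))\<^sup>2))"
        using q2 by (subst sum_ennreal[symmetric])
          (simp_all add: sum_distrib_left ennreal_mult mult.assoc del: sum_ennreal)
      finally show ?thesis .
    qed
    have frequency: "(\<integral>\<^sup>+ l. indicator {0..} l * ennreal (4 * q * l powr (q - 3) * (norm (c l n))\<^sup>2) \<partial>lborel)
        = ennreal (q * 2 powr q / (q - 2) * \<mu> powr (q - 2) * norm (a n) powr p)" for n
    proof (cases "a n = 0")
      case True
      then show ?thesis by (simp add: c_def)
    next
      case False
      \<comment> \<open>The level up to which the frequency \<open>n\<close> is kept.\<close>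
      define b where "b = 2 * \<mu> * norm (a n) powr (1 - p)"
      have b: "0 \<le> b" "l * norm (a n) powr (p - 1) \<le> 2 * \<mu> \<longleftrightarrow> l \<le> b" for l
        using False \<mu> by (auto simp: b_def powr_diff field_simps)
      have "(\<integral>\<^sup>+ l. indicator {0..} l * ennreal (4 * q * l powr (q - 3) * (norm (c l n))\<^sup>2) \<partial>lborel)
          = (\<integral>\<^sup>+ l. indicator {0..b} l * ennreal ((4 * q * (norm (a n))\<^sup>2) * l powr (q - 3)) \<partial>lborel)"
        unfolding c_def b(2) by (intro nn_integral_cong) (auto simp: b(1) indicator_def mult_ac)
      also have "\<dots> = ennreal (4 * q * (norm (a n))\<^sup>2 * (b powr (q - 2) / (q - 2)))"
        using q2 b by (subst nn_integral_powr_from_0) auto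
      also have "b powr (q - 2) = 2 powr (q - 2) * \<mu> powr (q - 2) * norm (a n) powr (p - 2)"
      proof -
        have "(1 - p) * (q - 2) = p - 2" using qp2 by (simp add: algebra_simps)
        then show ?thesis by (simp add: b_def powr_mult powr_powr)
      qed
      also have "4 * q * (norm (a n))\<^sup>2 * (2 powr (q - 2) * \<mu> powr (q - 2) * norm (a n) powr (p - 2) / (q - 2))
          = q * 2 powr q / (q - 2) * \<mu> powr (q - 2) * norm (a n) powr p"
      proof -
        have "2 powr q = 4 * 2 powr (q - 2)" "norm (a n) powr p = (norm (a n))\<^sup>2 * norm (a n) powr (p - 2)"
          using False by (simp_all add: powr_diff)
        then show ?thesis by simp
      qed
      finally show ?thesis .
    qed
    interpret circle: sigma_finite_measure circle_measure
      by (rule sigma_finite_circle_measure)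
    interpret pair_sigma_finite lborel circle_measure ..
    have [measurable]: "(\<lambda>x. snd x) \<in> borel_measurable (lborel \<Otimes>\<^sub>M circle_measure)"
      using measurable_compose[OF measurable_snd borel_measurable_circle_measureI[of "\<lambda>z. z"]] by simp
    have [measurable]: "case_prod h \<in> borel_measurable (lborel \<Otimes>\<^sub>M circle_measure)"
      unfolding h_def G_def c_def case_prod_beta by measurable
    have "(\<integral>\<^sup>+ z. ennreal (f z powr q) \<partial>circle_measure) \<le> (\<integral>\<^sup>+ z. \<integral>\<^sup>+ l. h l z \<partial>lborel \<partial>circle_measure)"
      by (intro nn_integral_mono pointwise) (simp add: space_circle_measure)
    also have "\<dots> = (\<integral>\<^sup>+ l. \<integral>\<^sup>+ z. h l z \<partial>circle_measure \<partial>lborel)"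
      by (rule Fubini') measurable
    also have "\<dots> = (\<Sum>n\<in>A. \<integral>\<^sup>+ l. indicator {0..} l * ennreal (4 * q * l powr (q - 3) * (norm (c l n))\<^sup>2) \<partial>lborel)"
      unfolding level c_def by (intro nn_integral_sum) measurable
    also have "\<dots> = ennreal (\<Sum>n\<in>A. q * 2 powr q / (q - 2) * \<mu> powr (q - 2) * norm (a n) powr p)"
      unfolding frequency using q2 by (intro sum_ennreal) auto
    also have "(\<Sum>n\<in>A. q * 2 powr q / (q - 2) * \<mu> powr (q - 2) * norm (a n) powr p)
        = q * 2 powr q / (q - 2) * (\<mu> powr (q - 2) * \<mu>)"
      unfolding sum_distrib_left[symmetric] \<mu>_def[symmetric] by (simp add: mult.assoc)
    also have "\<mu> powr (q - 2) * \<mu> = \<mu> powr (q / p)"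
      unfolding qp using \<mu> by (simp add: powr_diff field_simps power2_eq_square)
    finally show ?thesis by (simp add: f_def \<mu>_def)
  qed
qed

section \<open>Optimal chains\<close>

text \<open>
  The largest sum \<open>\<Sum> d n\<^sub>j n\<^sub>j\<^sub>+\<^sub>1\<close> over chains \<open>x = n\<^sub>0 < \<dots> < n\<^sub>K = y\<close>.  Recursion over the last step
  replaces the supremum over chains by finitely many sums and maxima, which makes measurability
  immediate and gives the splitting estimate below by induction on the right endpoint.
\<close>

function best_chain :: "(nat \<Rightarrow> nat \<Rightarrow> real) \<Rightarrow> nat \<Rightarrow> nat \<Rightarrow> real" where
  "best_chain d x y = (if y \<le> x then 0 else Max ((\<lambda>j. best_chain d x j + d j y) ` {x..<y}))"
  by auto
termination by (relation "Wellfounded.measure (\<lambda>(d, x, y). y)") auto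

declare best_chain.simps [simp del]

lemma best_chain_self [simp]: "best_chain d x x = 0"
  by (simp add: best_chain.simps)

lemma best_chain_step:
  assumes "x \<le> j" "j < y"
  shows "best_chain d x j + d j y \<le> best_chain d x y"
  using assms by (subst (2) best_chain.simps) (auto intro!: Max_ge)

lemma best_chain_last_step:
  assumes "x < y"
  obtains j where "x \<le> j" "j < y" "best_chain d x y = best_chain d x j + d j y"
proof -
  have "Max ((\<lambda>j. best_chain d x j + d j y) ` {x..<y}) \<in> (\<lambda>j. best_chain d x j + d j y) ` {x..<y}"
    using assms by (intro Max_in) auto
  moreover have "best_chain d x y = Max ((\<lambda>j. best_chain d x j + d j y) ` {x..<y})"
    using assms by (subst best_chain.simps) simp
  ultimately show ?thesis
    using that by auto
qed

lemma best_chain_mono: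
  assumes "\<And>i j. 0 \<le> d i j" "x \<le> j" "j \<le> y"
  shows "best_chain d x j \<le> best_chain d x y"
  using best_chain_step[of x j y d] assms(1)[of j y] assms(2,3) by (cases "j = y") auto

lemma best_chain_nonneg:
  assumes "\<And>i j. 0 \<le> d i j"
  shows "0 \<le> best_chain d x y"
  using best_chain_mono[of d x x y] assms
  by (cases "x \<le> y") (auto simp: best_chain.simps[of d x y])

lemma chain_sum_le_best_chain:
  assumes "\<And>j. j < K \<Longrightarrow> N j < N (Suc j)" "x \<le> N 0"
    and d: "\<And>i j. 0 \<le> d i j"
  shows "(\<Sum>j<K. d (N j) (N (Suc j))) \<le> best_chain d x (N K)"
  using assms(1)
proof (induction K)
  case 0
  then show ?case using best_chain_nonneg[OF d] by simp
next
  case (Suc K)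
  note step = Suc.prems
  have "x \<le> N j" if "j \<le> K" for j
    using that
  proof (induction j)
    case (Suc j)
    then show ?case using step[of j] by auto
  qed (use assms(2) in auto)
  then have "best_chain d x (N K) + d (N K) (N (Suc K)) \<le> best_chain d x (N (Suc K))"
    using Suc.prems by (intro best_chain_step) auto
  then show ?case using Suc by auto
qed

text \<open>
  At most one step \<open>(j, l)\<close> of a chain has \<open>j \<le> k < l\<close>.  Replacing it by the step from \<open>j\<close> to \<open>k\<close>
  leaves a chain from \<open>x\<close> to \<open>k\<close>, and the rest of the chain lies to the right of \<open>k\<close>; the price is
  the factor \<open>\<alpha>\<close> and the term \<open>\<beta>\<close>, paid once.
\<close>

lemma best_chain_split:
  assumes d: "\<And>i j. 0 \<le> d i j" and "1 \<le> \<alpha>" "0 \<le> \<beta>" "x \<le> k"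
    and cross: "\<And>j l. x \<le> j \<Longrightarrow> j \<le> k \<Longrightarrow> k < l \<Longrightarrow> l \<le> y \<Longrightarrow> d j l \<le> \<alpha> * d j k + \<beta>"
    and "k < y" and diag: "d k k = 0"
  shows "best_chain d x y \<le> \<alpha> * (best_chain d x k + best_chain d (Suc k) y) + \<beta>"
proof -
  have "best_chain d x l \<le> \<alpha> * (best_chain d x k + best_chain d (Suc k) l) + \<beta>" if "k < l" "l \<le> y" for l
    using that
  proof (induction l rule: less_induct)
    case (less l)
    have scale: "u \<le> \<alpha> * u" if "0 \<le> u" for u
      using mult_right_mono[OF \<open>1 \<le> \<alpha>\<close> that] by simp
    obtain j where j: "x \<le> j" "j < l" "best_chain d x l = best_chain d x j + d j l"
      using best_chain_last_step[of x l d] less.prems \<open>x \<le> k\<close> by auto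
    show ?case
    proof (cases "j \<le> k")
      case True
      have up: "best_chain d x j + d j k \<le> best_chain d x k"
        using True j best_chain_step[of x j k d] diag by (cases "j = k") auto
      have "best_chain d x l \<le> \<alpha> * best_chain d x j + (\<alpha> * d j k + \<beta>)"
        unfolding j(3) using True j less.prems d
        by (intro add_mono cross scale best_chain_nonneg) auto
      also have "\<dots> = \<alpha> * ((best_chain d x j + d j k) + 0) + \<beta>"
        by (simp add: algebra_simps)
      also have "\<dots> \<le> \<alpha> * (best_chain d x k + best_chain d (Suc k) l) + \<beta>"
        using j \<open>1 \<le> \<alpha>\<close> best_chain_nonneg[OF d] up
        by (intro add_mono mult_left_mono) auto
      finally show ?thesis .
    next
      case False
      have "best_chain d x l \<le> \<alpha> * (best_chain d x k + best_chain d (Suc k) j) + \<beta> + \<alpha> * d j l"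
        unfolding j(3) using False j less.prems d by (intro add_mono less.IH scale) auto
      also have "\<dots> = \<alpha> * (best_chain d x k + (best_chain d (Suc k) j + d j l)) + \<beta>"
        by (simp add: algebra_simps)
      also have "\<dots> \<le> \<alpha> * (best_chain d x k + best_chain d (Suc k) l) + \<beta>"
        using False j \<open>1 \<le> \<alpha>\<close> by (intro add_mono mult_left_mono best_chain_step) auto
      finally show ?thesis .
    qed
  qed
  then show ?thesis using \<open>k < y\<close> by simp
qed

lemma borel_measurable_best_chain:
  assumes "\<And>i j. (\<lambda>z. d z i j) \<in> borel_measurable M"
  shows "(\<lambda>z. best_chain (d z) x y) \<in> borel_measurable M"
proof (induction y rule: less_induct)
  case (less y)
  then show ?case
    using assms by (subst best_chain.simps) (auto intro!: borel_measurable_Max borel_measurable_add)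
qed

section \<open>Partial sums of a trigonometric series\<close>

definition block :: "(nat \<Rightarrow> complex) \<Rightarrow> complex \<Rightarrow> nat \<Rightarrow> nat \<Rightarrow> real" where
  "block a z x y = norm (\<Sum>n\<in>{x..<y}. a n * z ^ n)"

definition prefix_max :: "(nat \<Rightarrow> complex) \<Rightarrow> complex \<Rightarrow> nat \<Rightarrow> nat \<Rightarrow> real" where
  "prefix_max a z x y = Max (block a z x ` {x..y})"

lemma block_nonneg [simp]: "0 \<le> block a z x y"
  by (simp add: block_def)

lemma block_self [simp]: "block a z x x = 0"
  by (simp add: block_def)

lemma borel_measurable_block [measurable]: "(\<lambda>z. block a z x y) \<in> borel_measurable circle_measure"
  unfolding block_def by (intro borel_measurable_circle_measureI) measurable

lemma borel_measurable_prefix_max [measurable]: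
  "(\<lambda>z. prefix_max a z x y) \<in> borel_measurable circle_measure"
  unfolding prefix_max_def by measurable

lemma block_le_prefix_max: "x \<le> k \<Longrightarrow> k \<le> y \<Longrightarrow> block a z x k \<le> prefix_max a z x y"
  by (simp add: prefix_max_def)

lemma prefix_max_nonneg: "x \<le> y \<Longrightarrow> 0 \<le> prefix_max a z x y"
  using block_le_prefix_max[of x x y a z] by simp

lemma block_through_le:
  assumes "norm z = 1" "x \<le> k" "k < l"
  shows "block a z x l \<le> block a z x k + norm (a k) + block a z (Suc k) l"
proof -
  have "(\<Sum>n\<in>{x..<l}. a n * z ^ n) =
      (\<Sum>n\<in>{x..<k}. a n * z ^ n) + (a k * z ^ k + (\<Sum>n\<in>{Suc k..<l}. a n * z ^ n))"
    using assms sum.atLeastLessThan_concat[of x k l "\<lambda>n. a n * z ^ n"]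
    by (simp add: sum.atLeast_Suc_lessThan)
  also have "norm \<dots> \<le> norm (\<Sum>n\<in>{x..<k}. a n * z ^ n)
      + (norm (a k * z ^ k) + norm (\<Sum>n\<in>{Suc k..<l}. a n * z ^ n))"
    by (intro norm_triangle_le add_mono norm_triangle_ineq order_refl)
  finally show ?thesis
    using assms by (simp add: block_def norm_mult norm_power)
qed

lemma nn_integral_block_le:
  fixes p q :: real
  assumes "1 < p" "p < 2" "1 / p + 1 / q = 1" 
  shows "(\<integral>\<^sup>+ z. ennreal (block a z x y powr q) \<partial>circle_measure)
     \<le> ennreal (q * 2 powr q / (q - 2) * (\<Sum>n\<in>{x..<y}. norm (a n) powr p) powr (q / p))"
  unfolding block_def by (intro hausdorff_young_trig_poly assms) auto

lemma norm_powr_le_sum_powr: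
  fixes a :: "nat \<Rightarrow> complex" and p q :: real
  assumes "0 < p" "0 \<le> q" "x \<le> k" "k < y"
  shows "norm (a k) powr q \<le> (\<Sum>n\<in>{x..<y}. norm (a n) powr p) powr (q / p)"
proof -
  have "norm (a k) powr q = (norm (a k) powr p) powr (q / p)"
    using assms by (simp add: powr_powr)
  also have "\<dots> \<le> (\<Sum>n\<in>{x..<y}. norm (a n) powr p) powr (q / p)"
    using assms by (intro powr_mono2 member_le_sum) auto
  finally show ?thesis .
qed

lemma sum_powr_mono_interval:
  fixes a :: "nat \<Rightarrow> complex" and p s :: real
  assumes "0 \<le> s" "x \<le> i" "j \<le> y"
  shows "(\<Sum>n\<in>{i..<j}. norm (a n) powr p) powr s \<le> (\<Sum>n\<in>{x..<y}. norm (a n) powr p) powr s"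
  using assms by (intro powr_mono2 sum_mono2 sum_nonneg) auto

section \<open>Maximal and variational inequalities\<close>

text \<open>
  A largest initial sum either ends in the left part, or consists of the full left sum, the middle
  term and an initial sum of the right part.  The full left sum and the middle term are error terms
  by Hausdorff--Young, so the \<open>q\<close>th moment obeys the halving recursion with \<open>\<theta> = (1 + \<delta>)\<^sup>q\<close>.
\<close>

lemma maximal_hausdorff_young:
  fixes p q :: real
  assumes p: "1 < p" "p < 2" and pq: "1 / p + 1 / q = 1"
  obtains C where "0 \<le> C"
    "\<And>a x y. x \<le> y \<Longrightarrow> (\<integral>\<^sup>+ z. ennreal (prefix_max a z x y powr q) \<partial>circle_measure)
       \<le> ennreal (C * (\<Sum>n\<in>{x..<y}. norm (a n) powr p) powr (q / p))"
proof -
  have q: "2 < q" "0 < q / p" "1 < q / p"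
    using conjugate_exponent[OF p pq] by auto
  define H where "H = q * 2 powr q / (q - 2)"
  have H: "0 \<le> H" using q by (simp add: H_def)
  have "2 powr (1 - q / p) < (1::real)" using q by (simp add: powr_less_one)
  then obtain \<delta> where \<delta>: "0 < \<delta>" "(1 + \<delta>) powr q * 2 powr (1 - q / p) < 1"
    using ex_powr_mult_less_one by blast
  define \<theta> where "\<theta> = (1 + \<delta>) powr q"
  define \<gamma> where "\<gamma> = (1 + 1 / \<delta>) powr q"
  define B where "B = \<gamma> * (2 powr (q - 1) * (H + 1))"
  have \<gamma>: "0 \<le> \<gamma>" by (simp add: \<gamma>_def)
  have \<theta>: "1 \<le> \<theta>" using \<delta> q by (simp add: \<theta>_def ge_one_powr_ge_zero)
  define U where "U a x y = (\<integral>\<^sup>+ z. ennreal (prefix_max a z x y powr q) \<partial>circle_measure)" for a x y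
  have rec: "U a x y \<le> ennreal \<theta> * (U a x k + U a (Suc k) y)
      + ennreal (B * (\<Sum>n\<in>{x..<y}. norm (a n) powr p) powr (q / p))" if k: "x \<le> k" "k < y" for a x k y
  proof -
    define S where "S = (\<Sum>n\<in>{x..<y}. norm (a n) powr p) powr (q / p)"
    have pointwise: "prefix_max a z x y powr q \<le>
        \<theta> * (prefix_max a z x k powr q + prefix_max a z (Suc k) y powr q)
        + \<gamma> * (2 powr (q - 1) * (block a z x k powr q + norm (a k) powr q))" if z: "norm z = 1" for z
    proof -
      have "prefix_max a z x y \<in> block a z x ` {x..y}"
        unfolding prefix_max_def using k by (intro Max_in) auto
      then obtain l where l: "x \<le> l" "l \<le> y" "prefix_max a z x y = block a z x l"
        by auto
      show ?thesis
      proof (cases "l \<le> k")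
        case True
        have "prefix_max a z x y powr q \<le> prefix_max a z x k powr q"
          unfolding l(3) using True l q by (intro powr_mono2 block_le_prefix_max) auto
        also have "\<dots> \<le> \<theta> * prefix_max a z x k powr q"
          using mult_right_mono[OF \<theta>, of "prefix_max a z x k powr q"] by simp
        finally show ?thesis
          using \<theta> \<gamma> by (simp add: distrib_left add_increasing2)
      next
        case False
        have "prefix_max a z x y powr q \<le> (prefix_max a z (Suc k) y + (block a z x k + norm (a k))) powr q"
          unfolding l(3) using False l k q block_through_le[OF z, of x k l a] block_le_prefix_max[of "Suc k" l y a z]
          by (intro powr_mono2) auto
        also have "\<dots> \<le> \<theta> * prefix_max a z (Suc k) y powr q + \<gamma> * (block a z x k + norm (a k)) powr q"
          unfolding \<theta>_def \<gamma>_def using \<delta> q k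
          by (intro powr_add_le_epsilon prefix_max_nonneg) auto
        also have "\<dots> \<le> \<theta> * prefix_max a z (Suc k) y powr q
            + \<gamma> * (2 powr (q - 1) * (block a z x k powr q + norm (a k) powr q))"
          using \<gamma> q by (intro add_left_mono mult_left_mono powr_add_le_two_powr) auto
        moreover have "0 \<le> \<theta> * prefix_max a z x k powr q"
          using \<theta> by simp
        ultimately show ?thesis
          by (simp add: distrib_left)
      qed
    qed
    have bound: "(\<integral>\<^sup>+ z. ennreal (block a z x k powr q) \<partial>circle_measure) \<le> ennreal (H * S)"
    proof -
      have "(\<integral>\<^sup>+ z. ennreal (block a z x k powr q) \<partial>circle_measure)
          \<le> ennreal (H * (\<Sum>n\<in>{x..<k}. norm (a n) powr p) powr (q / p))"
        unfolding H_def by (rule nn_integral_block_le) (use p pq in auto)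
      also have "\<dots> \<le> ennreal (H * S)"
        unfolding S_def using k q H by (intro ennreal_leI mult_left_mono sum_powr_mono_interval) auto
      finally show ?thesis .
    qed
    have "U a x y \<le> (\<integral>\<^sup>+ z. ennreal \<theta> * (ennreal (prefix_max a z x k powr q) + ennreal (prefix_max a z (Suc k) y powr q))
        + ennreal (\<gamma> * 2 powr (q - 1)) * (ennreal (block a z x k powr q) + ennreal (norm (a k) powr q)) \<partial>circle_measure)"
      unfolding U_def
    proof (intro nn_integral_mono)
      fix z assume "z \<in> space circle_measure"
      then show "ennreal (prefix_max a z x y powr q) \<le> ennreal \<theta> * (ennreal (prefix_max a z x k powr q) + ennreal (prefix_max a z (Suc k) y powr q))
        + ennreal (\<gamma> * 2 powr (q - 1)) * (ennreal (block a z x k powr q) + ennreal (norm (a k) powr q))"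
        using pointwise[of z] \<theta> \<gamma>
        by (simp add: space_circle_measure mult.assoc flip: ennreal_plus ennreal_mult)
    qed
    also have "\<dots> = ennreal \<theta> * (U a x k + U a (Suc k) y)
        + ennreal (\<gamma> * 2 powr (q - 1)) * ((\<integral>\<^sup>+ z. ennreal (block a z x k powr q) \<partial>circle_measure) + ennreal (norm (a k) powr q))"
      by (simp add: nn_integral_add nn_integral_cmult U_def emeasure_circle_measure_space space_circle_measure)
    also have "\<dots> \<le> ennreal \<theta> * (U a x k + U a (Suc k) y) + ennreal (\<gamma> * 2 powr (q - 1)) * (ennreal (H * S) + ennreal S)"
      unfolding S_def using k p q 
      by (intro add_left_mono mult_left_mono add_mono bound[unfolded S_def] ennreal_leI norm_powr_le_sum_powr) auto
    also have "ennreal (\<gamma> * 2 powr (q - 1)) * (ennreal (H * S) + ennreal S) = ennreal (B * S)"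
      using H \<gamma> by (simp add: B_def S_def algebra_simps flip: ennreal_plus ennreal_mult)
    finally show ?thesis by (simp add: S_def)
  qed
  show ?thesis
  proof (rule that)
    show "0 \<le> B / (1 - \<theta> * 2 powr (1 - q / p))"
      using \<delta> \<gamma> H by (simp add: B_def \<theta>_def)
    fix a :: "nat \<Rightarrow> complex" and x y :: nat
    assume "x \<le> y"
    then show "(\<integral>\<^sup>+ z. ennreal (prefix_max a z x y powr q) \<partial>circle_measure)
       \<le> ennreal (B / (1 - \<theta> * 2 powr (1 - q / p)) * (\<Sum>n\<in>{x..<y}. norm (a n) powr p) powr (q / p))"
      unfolding U_def[symmetric]
      using \<delta> \<gamma> H q \<theta>
      by (intro splitting_recursion_bound rec) (auto simp: B_def \<theta>_def U_def prefix_max_def)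
  qed
qed

text \<open>
  \<open>best_chain\<close> is the \<open>r\<close>th power of the \<open>r\<close>-variation, since extending a
  chain to both endpoints can only increase its sum; its power \<open>t = q / r\<close> is integrated.  A step
  across the middle frequency \<open>k\<close> exceeds its left portion by at most the middle term plus an initial
  sum of the right part, whose \<open>q\<close>th moments are already under control.  Convexity of the \<open>t\<close>th power
  costs the factor \<open>2\<^bsup>t - 1\<^esup>\<close>, which halving compensates exactly when \<open>t < q / p\<close>.
\<close>

lemma variational_hausdorff_young:
  fixes p q r :: real
  assumes p: "1 < p" "p < 2" and pq: "1 / p + 1 / q = 1" and r: "p < r" "r \<le> q"
  obtains C where "0 \<le> C"
    "\<And>a x y. x \<le> y \<Longrightarrow>
       (\<integral>\<^sup>+ z. ennreal (best_chain (\<lambda>i j. block a z i j powr r) x y powr (q / r)) \<partial>circle_measure)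
       \<le> ennreal (C * (\<Sum>n\<in>{x..<y}. norm (a n) powr p) powr (q / p))"
proof -
  have q: "2 < q" "0 < q / p" "1 < q / p"
    using conjugate_exponent[OF p pq] by auto
  obtain M where M: "0 \<le> M" "\<And>a x y. x \<le> y \<Longrightarrow> (\<integral>\<^sup>+ z. ennreal (prefix_max a z x y powr q) \<partial>circle_measure)
       \<le> ennreal (M * (\<Sum>n\<in>{x..<y}. norm (a n) powr p) powr (q / p))"
    using maximal_hausdorff_young[OF p pq] by blast
  define t where "t = q / r"
  have t: "1 \<le> t" "r * t = q" "t < q / p"
    using r p q by (auto simp: t_def field_simps)
  \<comment> \<open>The exponent \<open>q + t\<close> accounts for the loss \<open>(1 + \<delta>)\<^sup>r\<close> in the splitting of the chain, raised to
    the power \<open>t\<close>, times the loss \<open>(1 + \<delta>)\<^sup>t\<close> in taking the \<open>t\<close>th power; recall \<open>r t = q\<close>.\<close>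
  have "2 powr (t - 1) * 2 powr (1 - q / p) < (1::real)"
    using t by (simp add: powr_less_one flip: powr_add)
  then obtain \<delta> where \<delta>: "0 < \<delta>" "(1 + \<delta>) powr (q + t) * (2 powr (t - 1) * 2 powr (1 - q / p)) < 1"
    using ex_powr_mult_less_one by blast
  define \<theta> where "\<theta> = (1 + \<delta>) powr (q + t) * 2 powr (t - 1)"
  define \<gamma> where "\<gamma> = (1 + 1 / \<delta>) powr (q + t) * 2 powr (q - 1)"
  define B where "B = \<gamma> * (1 + M)"
  have \<gamma>: "0 \<le> \<gamma>" and \<theta>: "0 \<le> \<theta>" by (simp_all add: \<gamma>_def \<theta>_def)
  define V where "V a z x y = best_chain (\<lambda>i j. block a z i j powr r) x y" for a z x y
  have V_nonneg: "0 \<le> V a z x y" for a z x y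
    unfolding V_def by (intro best_chain_nonneg) auto
  have [measurable]: "(\<lambda>z. V a z x y) \<in> borel_measurable circle_measure" for a x y
    unfolding V_def by (intro borel_measurable_best_chain) measurable
  define U where "U a x y = (\<integral>\<^sup>+ z. ennreal (V a z x y powr t) \<partial>circle_measure)" for a x y
  have rec: "U a x y \<le> ennreal \<theta> * (U a x k + U a (Suc k) y)
      + ennreal (B * (\<Sum>n\<in>{x..<y}. norm (a n) powr p) powr (q / p))" if k: "x \<le> k" "k < y" for a x k y
  proof -
    define S where "S = (\<Sum>n\<in>{x..<y}. norm (a n) powr p) powr (q / p)"
    have pointwise: "V a z x y powr t \<le> \<theta> * (V a z x k powr t + V a z (Suc k) y powr t)
        + \<gamma> * (norm (a k) powr q + prefix_max a z (Suc k) y powr q)" if z: "norm z = 1" for z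
    proof -
      define b where "b = norm (a k) + prefix_max a z (Suc k) y"
      have b: "0 \<le> b" using k prefix_max_nonneg[of "Suc k" y a z] by (simp add: b_def)
      have cross: "block a z j l powr r \<le> (1 + \<delta>) powr r * block a z j k powr r + (1 + 1 / \<delta>) powr r * b powr r"
        if "j \<le> k" "k < l" "l \<le> y" for j l
      proof -
        have "block a z j l powr r \<le> (block a z j k + b) powr r"
          using block_through_le[OF z, of j k l a] block_le_prefix_max[of "Suc k" l y a z] that p r
          by (intro powr_mono2) (auto simp: b_def)
        also have "\<dots> \<le> (1 + \<delta>) powr r * block a z j k powr r + (1 + 1 / \<delta>) powr r * b powr r"
          using b p r \<delta> by (intro powr_add_le_epsilon) auto
        finally show ?thesis .
      qed
      have "V a z x y \<le> (1 + \<delta>) powr r * (V a z x k + V a z (Suc k) y) + (1 + 1 / \<delta>) powr r * b powr r"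
        unfolding V_def using k \<delta> p r cross
        by (intro best_chain_split) (auto simp: ge_one_powr_ge_zero)
      then have "V a z x y powr t \<le>
          ((1 + \<delta>) powr r * (V a z x k + V a z (Suc k) y) + (1 + 1 / \<delta>) powr r * b powr r) powr t"
        using t V_nonneg by (intro powr_mono2) auto
      also have "\<dots> \<le> (1 + \<delta>) powr t * ((1 + \<delta>) powr r * (V a z x k + V a z (Suc k) y)) powr t
          + (1 + 1 / \<delta>) powr t * ((1 + 1 / \<delta>) powr r * b powr r) powr t"
        using t V_nonneg \<delta> by (intro powr_add_le_epsilon) auto
      also have "\<dots> = (1 + \<delta>) powr (q + t) * (V a z x k + V a z (Suc k) y) powr t
          + (1 + 1 / \<delta>) powr (q + t) * b powr q"
        by (simp add: powr_mult powr_powr t powr_add)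
      also have "\<dots> \<le> (1 + \<delta>) powr (q + t) * (2 powr (t - 1) * (V a z x k powr t + V a z (Suc k) y powr t))
          + (1 + 1 / \<delta>) powr (q + t) * (2 powr (q - 1) * (norm (a k) powr q + prefix_max a z (Suc k) y powr q))"
        unfolding b_def using t q V_nonneg k
        by (intro add_mono mult_left_mono powr_add_le_two_powr prefix_max_nonneg) auto
      finally show ?thesis by (simp add: \<theta>_def \<gamma>_def mult.assoc)
    qed
    have bound: "(\<integral>\<^sup>+ z. ennreal (prefix_max a z (Suc k) y powr q) \<partial>circle_measure) \<le> ennreal (M * S)"
    proof -
      have "(\<integral>\<^sup>+ z. ennreal (prefix_max a z (Suc k) y powr q) \<partial>circle_measure)
          \<le> ennreal (M * (\<Sum>n\<in>{Suc k..<y}. norm (a n) powr p) powr (q / p))"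
        by (rule M(2)) (use k in auto)
      also have "\<dots> \<le> ennreal (M * S)"
        unfolding S_def using k q M by (intro ennreal_leI mult_left_mono sum_powr_mono_interval) auto
      finally show ?thesis .
    qed
    have "U a x y \<le> (\<integral>\<^sup>+ z. ennreal \<theta> * (ennreal (V a z x k powr t) + ennreal (V a z (Suc k) y powr t))
        + ennreal \<gamma> * (ennreal (norm (a k) powr q) + ennreal (prefix_max a z (Suc k) y powr q)) \<partial>circle_measure)"
      unfolding U_def
    proof (intro nn_integral_mono)
      fix z assume "z \<in> space circle_measure"
      then show "ennreal (V a z x y powr t) \<le> ennreal \<theta> * (ennreal (V a z x k powr t) + ennreal (V a z (Suc k) y powr t))
        + ennreal \<gamma> * (ennreal (norm (a k) powr q) + ennreal (prefix_max a z (Suc k) y powr q))"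
        using pointwise[of z] \<theta> \<gamma>
        by (simp add: space_circle_measure flip: ennreal_plus ennreal_mult)
    qed
    also have "\<dots> = ennreal \<theta> * (U a x k + U a (Suc k) y)
        + ennreal \<gamma> * (ennreal (norm (a k) powr q) + (\<integral>\<^sup>+ z. ennreal (prefix_max a z (Suc k) y powr q) \<partial>circle_measure))"
      by (simp add: nn_integral_add nn_integral_cmult U_def emeasure_circle_measure_space space_circle_measure)
    also have "\<dots> \<le> ennreal \<theta> * (U a x k + U a (Suc k) y) + ennreal \<gamma> * (ennreal S + ennreal (M * S))"
      unfolding S_def using k p q 
      by (intro add_left_mono mult_left_mono add_mono bound[unfolded S_def] ennreal_leI norm_powr_le_sum_powr) auto
    also have "ennreal \<gamma> * (ennreal S + ennreal (M * S)) = ennreal (B * S)"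
      using M \<gamma> by (simp add: B_def S_def algebra_simps flip: ennreal_plus ennreal_mult)
    finally show ?thesis by (simp add: S_def)
  qed
  show ?thesis
  proof (rule that)
    show "0 \<le> B / (1 - \<theta> * 2 powr (1 - q / p))"
      using \<delta> \<gamma> M by (simp add: B_def \<theta>_def mult.assoc)
    fix a :: "nat \<Rightarrow> complex" and x y :: nat
    assume "x \<le> y"
    then show "(\<integral>\<^sup>+ z. ennreal (best_chain (\<lambda>i j. block a z i j powr r) x y powr (q / r)) \<partial>circle_measure)
       \<le> ennreal (B / (1 - \<theta> * 2 powr (1 - q / p)) * (\<Sum>n\<in>{x..<y}. norm (a n) powr p) powr (q / p))"
      unfolding V_def[symmetric] t_def[symmetric] U_def[symmetric]
      using \<delta> \<gamma> M q \<theta>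
      by (intro splitting_recursion_bound rec) (auto simp: B_def \<theta>_def U_def V_def mult.assoc)
  qed
qed

section \<open>The variation in terms of partial sums\<close>

lemma op_norm_antidiagonal:
  assumes "norm c = norm b"
  shows "op_norm (vector [vector [0, b], vector [c, 0]]) = norm b"
proof -
  have norm_image: "norm ((vector [vector [0, b], vector [c, 0]] :: complex^2^2) *v v) = norm b * norm v" for v :: "complex^2"
  proof -
    have "(norm (b * v $ 2))\<^sup>2 + (norm (c * v $ 1))\<^sup>2 = (norm b)\<^sup>2 * ((norm (v $ 1))\<^sup>2 + (norm (v $ 2))\<^sup>2)"
      using assms by (simp add: norm_mult power_mult_distrib algebra_simps)
    then show ?thesis
      by (simp add: norm_vec_def L2_set_def sum_2 matrix_vector_mult_def real_sqrt_mult)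
  qed
  have "onorm (\<lambda>v. (vector [vector [0, b], vector [c, 0]] :: complex^2^2) *v v) = norm b"
    unfolding onorm_def norm_image
  proof (rule cSup_eq_maximum)
    have "norm b = norm b * norm (axis 1 1 :: complex^2) / norm (axis 1 1 :: complex^2)"
      by (simp add: axis_eq_0_iff)
    then show "norm b \<in> range (\<lambda>v :: complex^2. norm b * norm v / norm v)"
      by blast
  qed auto
  then show ?thesis by (simp add: op_norm_def)
qed

lemma op_norm_sigma_diff:
  assumes "norm z = 1"
  shows "op_norm (sigma_diff F M N z) = norm (\<Sum>n\<in>{M<..N}. F n * z powi n)"
proof -
  have "z powi (- n) = cnj (z powi n)" for n
  proof -
    have "inverse z = cnj z"
      using assms by (metis complex_div_cnj divide_inverse mult_1 of_real_1 one_power2 div_by_1)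
    then show ?thesis
      by (simp add: power_int_minus flip: power_int_inverse)
  qed
  then have "sigma_diff F M N z = vector [vector [0, \<Sum>n\<in>{M<..N}. F n * z powi n],
      vector [cnj (\<Sum>n\<in>{M<..N}. F n * z powi n), 0]]"
    by (simp add: sigma_diff_def fourier_matrix_def vec_eq_iff forall_2)
  then show ?thesis by (simp only: op_norm_antidiagonal complex_mod_cnj)
qed

lemma op_norm_nonneg: "norm z = 1 \<Longrightarrow> 0 \<le> op_norm (sigma_diff F M N z)"
  by (simp add: op_norm_sigma_diff)

text \<open>
  Shifting the frequencies by \<open>c + 1\<close> multiplies the sum by a unimodular factor.
\<close>

lemma op_norm_sigma_diff_eq_block:
  assumes z: "norm z = 1" and "c \<le> M" "c \<le> N"
  shows "op_norm (sigma_diff F M N z) = block (\<lambda>n. F (c + 1 + int n)) z (nat (M - c)) (nat (N - c))"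
proof -
  have "(\<Sum>n\<in>{M<..N}. F n * z powi n) =
      (\<Sum>n\<in>{nat (M - c)..<nat (N - c)}. F (c + 1 + int n) * z powi (c + 1 + int n))"
    by (rule sum.reindex_bij_witness[of _ "\<lambda>n. c + 1 + int n" "\<lambda>n. nat (n - c - 1)"])
       (use assms in auto)
  also have "\<dots> = z powi (c + 1) * (\<Sum>n\<in>{nat (M - c)..<nat (N - c)}. F (c + 1 + int n) * z ^ n)"
  proof -
    have "z \<noteq> 0" using z by auto
    then show ?thesis
      by (simp add: sum_distrib_left power_int_add mult_ac)
  qed
  finally show ?thesis
    using z by (simp add: op_norm_sigma_diff block_def norm_mult norm_power_int)
qed

lemma borel_measurable_op_norm_sigma_diff [measurable]:
  "(\<lambda>z. op_norm (sigma_diff F M N z)) \<in> borel_measurable circle_measure"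
proof -
  have "(\<lambda>z. op_norm (sigma_diff F M N z)) \<in> borel_measurable circle_measure \<longleftrightarrow>
      (\<lambda>z. block (\<lambda>n. F (min M N + 1 + int n)) z (nat (M - min M N)) (nat (N - min M N)))
        \<in> borel_measurable circle_measure"
    by (intro measurable_cong op_norm_sigma_diff_eq_block) (auto simp: space_circle_measure)
  then show ?thesis by simp
qed

text \<open>
  The inner supremum ranges over uncountably many functions \<open>N\<close>, but only the restrictions of \<open>N\<close>
  to \<open>{..K}\<close> matter, and there are countably many of these.
\<close>

lemma borel_measurable_variation: "variation r F \<in> borel_measurable circle_measure"
proof (cases "r = \<infinity>")
  case True
  have "(\<lambda>z. SUP i\<in>{(M, N). M < N}. ennreal (op_norm (sigma_diff F (fst i) (snd i) z)))
      \<in> borel_measurable circle_measure"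
    by (intro borel_measurable_SUP) auto
  then show ?thesis
    using True by (simp add: variation_def[abs_def] case_prod_beta)
next
  case False
  define g where "g K N z = ennreal ((\<Sum>j<K. op_norm (sigma_diff F (N j) (N (Suc j)) z) powr enn2real r)
      powr (1 / enn2real r))" for K and N :: "nat \<Rightarrow> int" and z
  define I where "I K = {N :: nat \<Rightarrow> int. strict_mono_on {..K} N}" for K
  have "(SUP N\<in>I K. g K N z) = (SUP N\<in>I K \<inter> PiE {..K} (\<lambda>_. UNIV). g K N z)" for K z
  proof (intro antisym SUP_least)
    fix N assume N: "N \<in> I K"
    have "g K N z = g K (restrict N {..K}) z"
      by (simp add: g_def)
    also have "\<dots> \<le> (SUP N\<in>I K \<inter> PiE {..K} (\<lambda>_. UNIV). g K N z)"
    proof (rule SUP_upper)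
      have "restrict N {..K} \<in> I K"
        using N by (auto simp: I_def strict_mono_on_def)
      then show "restrict N {..K} \<in> I K \<inter> PiE {..K} (\<lambda>_. UNIV)"
        by (intro IntI restrict_PiE_iff[THEN iffD2]) auto
    qed
    finally show "g K N z \<le> (SUP N\<in>I K \<inter> PiE {..K} (\<lambda>_. UNIV). g K N z)" .
  qed (auto intro: SUP_upper)
  then have "variation r F = (\<lambda>z. SUP K\<in>{1..}. SUP N\<in>I K \<inter> PiE {..K} (\<lambda>_. UNIV). g K N z)"
    using False by (simp add: variation_def[abs_def] g_def I_def)
  moreover have "countable (I K \<inter> PiE {..K} (\<lambda>_. UNIV))" for K
    by (intro countable_Int2 countable_PiE) auto
  then have "(\<lambda>z. SUP K\<in>{1..}. SUP N\<in>I K \<inter> PiE {..K} (\<lambda>_. UNIV). g K N z) \<in> borel_measurable circle_measure"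
    unfolding g_def by (intro borel_measurable_SUP) auto
  ultimately show ?thesis by simp
qed

text \<open>
  It suffices to bound the \<open>s\<close>-variation for a single real \<open>s \<le> r\<close>.  For \<open>r = \<infinity>\<close>, a pair \<open>M < N\<close> is a
  chain with one step.
\<close>

lemma variation_leI:
  assumes z: "norm z = 1" and s: "0 < s" "ennreal s \<le> r"
    and le: "\<And>K N. strict_mono_on {..K} N \<Longrightarrow>
      ennreal ((\<Sum>j<K. op_norm (sigma_diff F (N j) (N (Suc j)) z) powr s) powr (1 / s)) \<le> c"
  shows "variation r F z \<le> c"
proof (cases "r = \<infinity>")
  case True
  have "ennreal (op_norm (sigma_diff F M N z)) \<le> c" if "M < N" for M N
  proof -
    have "strict_mono_on {..1} (\<lambda>j::nat. if j = 0 then M else N)"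
      using that by (auto simp: strict_mono_on_def)
    from le[OF this] show ?thesis
      using s op_norm_nonneg[OF z] by (simp add: powr_powr)
  qed
  then show ?thesis
    using True by (auto simp: variation_def intro!: SUP_least)
next
  case False
  then obtain r' where r': "r = ennreal r'" "0 \<le> r'" by (cases r) auto
  have "ennreal ((\<Sum>j<K. op_norm (sigma_diff F (N j) (N (Suc j)) z) powr r') powr (1 / r')) \<le> c"
    if "strict_mono_on {..K} N" for K and N :: "nat \<Rightarrow> int"
  proof -
    have "(\<Sum>j<K. op_norm (sigma_diff F (N j) (N (Suc j)) z) powr r') powr (1 / r')
        \<le> (\<Sum>j<K. op_norm (sigma_diff F (N j) (N (Suc j)) z) powr s) powr (1 / s)"
      using s r' op_norm_nonneg[OF z] by (intro powr_sum_le_powr_of_smaller_exponent) auto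
    then show ?thesis
      using le[OF that] by (meson ennreal_leI order_trans)
  qed
  then show ?thesis
    using False r' by (auto simp: variation_def intro!: SUP_least)
qed

section \<open>Passage to infinitely many frequencies\<close>

lemma epowr_ennreal: "0 \<le> x \<Longrightarrow> epowr (ennreal x) a = ennreal (x powr a)"
  by (simp add: epowr_def)

lemma epowr_mono: "x \<le> y \<Longrightarrow> 0 \<le> a \<Longrightarrow> epowr x a \<le> epowr y a"
  by (cases x; cases y) (auto simp: epowr_def top_unique intro!: ennreal_leI powr_mono2)

lemma epowr_inverse: "0 < a \<Longrightarrow> epowr (epowr x (1 / a)) a = x"
  by (cases x) (auto simp: epowr_def powr_powr)

text \<open>
  Taking powers is an order isomorphism; this moves the power \<open>q\<close> out of the suprema that define the
  variation.
\<close>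

lemma le_epowr_inverseI:
  assumes "epowr x a \<le> y" "0 < a"
  shows "x \<le> epowr y (1 / a)"
  using epowr_mono[OF assms(1), of "1 / a"] epowr_inverse[of "1 / a" x] assms(2) by simp

text \<open>
  The coefficients shifted so that the indices in \<open>[0, 2 L)\<close> are the frequencies from \<open>1 - L\<close>
  to \<open>L\<close>, and a partition point \<open>N\<close>, after which a block starts with \<open>N + 1\<close>, becomes \<open>N + L\<close>.
\<close>

definition window :: "(int \<Rightarrow> complex) \<Rightarrow> nat \<Rightarrow> nat \<Rightarrow> complex" where
  "window F L n = F (1 - int L + int n)"

lemma chain_sum_le_window_best_chain:
  assumes z: "norm z = 1" and N: "strict_mono_on {..K} N"
    and L: "- int L \<le> N 0" "N K \<le> int L"
  shows "(\<Sum>j<K. op_norm (sigma_diff F (N j) (N (Suc j)) z) powr s)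
     \<le> best_chain (\<lambda>i j. block (window F L) z i j powr s) 0 (2 * L)"
proof -
  define n where "n j = nat (N j + int L)" for j
  have lower: "- int L \<le> N j" if "j \<le> K" for j
    using strict_mono_onD[OF N, of 0 j] L(1) that by (cases "j = 0") auto
  have step: "N j < N (Suc j)" if "j < K" for j
    using strict_mono_onD[OF N, of j "Suc j"] that by auto
  have "op_norm (sigma_diff F (N j) (N (Suc j)) z) = block (window F L) z (n j) (n (Suc j))" if "j < K" for j
    using op_norm_sigma_diff_eq_block[OF z, of "- int L" "N j" "N (Suc j)" F] lower[of j] lower[of "Suc j"] that
    by (simp add: n_def window_def[abs_def])
  then have "(\<Sum>j<K. op_norm (sigma_diff F (N j) (N (Suc j)) z) powr s) =
      (\<Sum>j<K. block (window F L) z (n j) (n (Suc j)) powr s)"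
    by simp
  also have "\<dots> \<le> best_chain (\<lambda>i j. block (window F L) z i j powr s) 0 (n K)"
  proof (rule chain_sum_le_best_chain)
    show "n j < n (Suc j)" if "j < K" for j
      using lower[of j] step[OF that] that by (simp add: n_def)
  qed auto
  also have "\<dots> \<le> best_chain (\<lambda>i j. block (window F L) z i j powr s) 0 (2 * L)"
    using L by (intro best_chain_mono) (auto simp: n_def)
  finally show ?thesis .
qed

text \<open>
  A fixed partition lies in all sufficiently large windows, so its contribution is below the limit
  inferior.
\<close>

lemma variation_powr_le_liminf:
  assumes z: "norm z = 1" and s: "0 < s" "ennreal s \<le> r" and q: "0 < q"
  shows "epowr (variation r F z) q \<le>
    liminf (\<lambda>L. ennreal (best_chain (\<lambda>i j. block (window F L) z i j powr s) 0 (2 * L) powr (q / s)))"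
    (is "_ \<le> ?l")
proof -
  have "variation r F z \<le> epowr ?l (1 / q)"
  proof (rule variation_leI[OF z s])
    fix K and N :: "nat \<Rightarrow> int"
    assume N: "strict_mono_on {..K} N"
    define T where "T = (\<Sum>j<K. op_norm (sigma_diff F (N j) (N (Suc j)) z) powr s)"
    have T: "0 \<le> T" by (simp add: T_def sum_nonneg)
    have "\<forall>\<^sub>F L in sequentially. ennreal (T powr (q / s))
        \<le> ennreal (best_chain (\<lambda>i j. block (window F L) z i j powr s) 0 (2 * L) powr (q / s))"
      using eventually_ge_at_top[of "nat (\<bar>N 0\<bar> + \<bar>N K\<bar>)"]
    proof eventually_elim
      case (elim L)
      then show ?case
        unfolding T_def using s q
        by (intro ennreal_leI powr_mono2 chain_sum_le_window_best_chain z N sum_nonneg) auto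
    qed
    then have "ennreal (T powr (q / s)) \<le> ?l"
      by (rule Liminf_bounded)
    then have "ennreal (T powr (1 / s)) \<le> epowr ?l (1 / q)"
      using q T by (intro le_epowr_inverseI) (simp_all add: epowr_ennreal powr_powr)
    then show "ennreal ((\<Sum>j<K. op_norm (sigma_diff F (N j) (N (Suc j)) z) powr s) powr (1 / s))
        \<le> epowr ?l (1 / q)"
      by (simp add: T_def)
  qed
  then show ?thesis
    using epowr_mono[of "variation r F z" "epowr ?l (1 / q)" q] epowr_inverse[of q ?l] q by simp
qed

lemma sum_le_nn_integral_count_space:
  fixes f :: "'a \<Rightarrow> ennreal"
  assumes "finite A"
  shows "sum f A \<le> (\<integral>\<^sup>+ n. f n \<partial>count_space UNIV)"
proof -
  have "sum f A = (\<integral>\<^sup>+ n. f n * indicator A n \<partial>count_space UNIV)"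
    using assms by (simp add: nn_integral_count_space_finite flip: nn_integral_count_space_indicator)
  also have "\<dots> \<le> (\<integral>\<^sup>+ n. f n \<partial>count_space UNIV)"
    by (intro nn_integral_mono) (auto simp: indicator_def)
  finally show ?thesis .
qed

lemma lp_norm_real_exponent:
  assumes p: "0 < p" and F: "lp_norm (ennreal p) F < \<infinity>"
  obtains S where "0 \<le> S" "lp_norm (ennreal p) F = ennreal (S powr (1 / p))"
    "\<And>A. finite A \<Longrightarrow> (\<Sum>n\<in>A. norm (F n) powr p) \<le> S"
proof -
  define T where "T = (\<integral>\<^sup>+ n. ennreal (norm (F n) powr p) \<partial>count_space UNIV)"
  have norm_eq: "lp_norm (ennreal p) F = epowr T (1 / p)"
    using p by (simp add: lp_norm_def Lq_norm_def T_def epowr_ennreal)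
  then obtain S where S: "T = ennreal S" "0 \<le> S"
    using F by (cases T) (auto simp: epowr_def)
  have "(\<Sum>n\<in>A. norm (F n) powr p) \<le> S" if "finite A" for A
  proof -
    have "ennreal (\<Sum>n\<in>A. norm (F n) powr p) \<le> T"
      using sum_le_nn_integral_count_space[OF that, of "\<lambda>n. ennreal (norm (F n) powr p)"]
      by (simp add: T_def)
    then show ?thesis using S by simp
  qed
  then show ?thesis
    using that[of S] S norm_eq by (simp add: epowr_ennreal)
qed

text \<open>
  The blocks of a partition are disjoint, and each is bounded by the sum of the moduli of its coefficients.
\<close>

lemma variation_le_l1_norm:
  assumes z: "norm z = 1" and F: "lp_norm 1 F < \<infinity>" and r: "1 \<le> r"
  shows "variation r F z \<le> lp_norm 1 F"
proof -
  obtain S where S: "0 \<le> S" "lp_norm 1 F = ennreal S" "\<And>A. finite A \<Longrightarrow> (\<Sum>n\<in>A. norm (F n)) \<le> S"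
    using lp_norm_real_exponent[of 1 F] F by auto
  show ?thesis
  proof (rule variation_leI[OF z, of 1])
    fix K and N :: "nat \<Rightarrow> int"
    assume N: "strict_mono_on {..K} N"
    have "(\<Sum>j<k. op_norm (sigma_diff F (N j) (N (Suc j)) z)) \<le> (\<Sum>n\<in>{N 0<..N k}. norm (F n))"
      if "k \<le> K" for k
      using that
    proof (induction k)
      case (Suc k)
      have le: "N 0 \<le> N k" "N k \<le> N (Suc k)"
        using strict_mono_onD[OF N, of 0 k] strict_mono_onD[OF N, of k "Suc k"] Suc.prems
        by (cases "k = 0"; auto)+
      have "op_norm (sigma_diff F (N k) (N (Suc k)) z) \<le> (\<Sum>n\<in>{N k<..N (Suc k)}. norm (F n))"
        unfolding op_norm_sigma_diff[OF z] using z
        by (intro sum_norm_le) (simp add: norm_mult norm_power_int)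
      moreover have "(\<Sum>n\<in>{N 0<..N k}. norm (F n)) + (\<Sum>n\<in>{N k<..N (Suc k)}. norm (F n))
          = (\<Sum>n\<in>{N 0<..N (Suc k)}. norm (F n))"
        using le by (subst sum.union_disjoint[symmetric]) (auto intro!: sum.cong)
      ultimately show ?case using Suc by simp
    qed auto
    then have "(\<Sum>j<K. op_norm (sigma_diff F (N j) (N (Suc j)) z)) \<le> S"
      using S(3)[of "{N 0<..N K}"] by fastforce
    then show "ennreal ((\<Sum>j<K. op_norm (sigma_diff F (N j) (N (Suc j)) z) powr 1) powr (1 / 1)) \<le> lp_norm 1 F"
      using op_norm_nonneg[OF z] by (simp add: S(2) sum_nonneg ennreal_leI)
  qed (use r in auto)
qed

lemma variation_Lq_norm_le:
  fixes p q s :: real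
  assumes p: "1 < p" "p < 2" and pq: "1 / p + 1 / q = 1" and s: "p < s" "s \<le> q" "ennreal s \<le> r"
  obtains C where "0 \<le> C"
    "\<And>F. lp_norm (ennreal p) F < \<infinity> \<Longrightarrow>
       Lq_norm (ennreal q) circle_measure (variation r F) \<le> ennreal C * lp_norm (ennreal p) F"
proof -
  have q: "2 < q" using conjugate_exponent[OF p pq] by simp
  obtain C where C: "0 \<le> C"
    "\<And>a x y. x \<le> y \<Longrightarrow>
       (\<integral>\<^sup>+ z. ennreal (best_chain (\<lambda>i j. block a z i j powr s) x y powr (q / s)) \<partial>circle_measure)
       \<le> ennreal (C * (\<Sum>n\<in>{x..<y}. norm (a n) powr p) powr (q / p))"
    using variational_hausdorff_young[OF p pq s(1,2)] by blast
  show ?thesis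
  proof (rule that)
    show "0 \<le> C powr (1 / q)" by simp
    fix F assume "lp_norm (ennreal p) F < \<infinity>"
    then obtain S where S: "0 \<le> S" "lp_norm (ennreal p) F = ennreal (S powr (1 / p))"
        "\<And>A. finite A \<Longrightarrow> (\<Sum>n\<in>A. norm (F n) powr p) \<le> S"
      using lp_norm_real_exponent[of p F] p by auto
    define W where "W L z = ennreal (best_chain (\<lambda>i j. block (window F L) z i j powr s) 0 (2 * L) powr (q / s))"
      for L z
    have [measurable]: "W L \<in> borel_measurable circle_measure" for L
      using borel_measurable_best_chain[of "\<lambda>z i j. block (window F L) z i j powr s" circle_measure 0 "2 * L"]
      unfolding W_def by measurable
    have W: "(\<integral>\<^sup>+ z. W L z \<partial>circle_measure) \<le> ennreal (C * S powr (q / p))" for L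
    proof -
      have "(\<Sum>n\<in>{0..<2 * L}. norm (window F L n) powr p)
          = (\<Sum>n\<in>(\<lambda>n. 1 - int L + int n) ` {0..<2 * L}. norm (F n) powr p)"
        by (simp add: sum.reindex inj_on_def window_def)
      also have "\<dots> \<le> S" by (intro S(3)) auto
      finally have "C * (\<Sum>n\<in>{0..<2 * L}. norm (window F L n) powr p) powr (q / p) \<le> C * S powr (q / p)"
        using p q C by (intro mult_left_mono powr_mono2 sum_nonneg) auto
      then show ?thesis
        unfolding W_def using C(2)[of 0 "2 * L" "window F L"] by (meson ennreal_leI order_trans zero_le)
    qed
    have "(\<integral>\<^sup>+ z. epowr (variation r F z) q \<partial>circle_measure) \<le> (\<integral>\<^sup>+ z. liminf (\<lambda>L. W L z) \<partial>circle_measure)"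
      unfolding W_def using p s q
      by (intro nn_integral_mono variation_powr_le_liminf) (auto simp: space_circle_measure)
    also have "\<dots> \<le> liminf (\<lambda>L. \<integral>\<^sup>+ z. W L z \<partial>circle_measure)"
      by (intro nn_integral_liminf) measurable
    also have "\<dots> \<le> liminf (\<lambda>L. ennreal (C * S powr (q / p)))"
      by (intro Liminf_mono always_eventually allI W)
    also have "\<dots> = ennreal (C * S powr (q / p))"
      by (simp add: Liminf_const)
    finally have "epowr (\<integral>\<^sup>+ z. epowr (variation r F z) q \<partial>circle_measure) (1 / q)
        \<le> epowr (ennreal (C * S powr (q / p))) (1 / q)"
      using q by (intro epowr_mono) auto
    also have "\<dots> = ennreal (C powr (1 / q)) * lp_norm (ennreal p) F"
    proof -
      have "(C * S powr (q / p)) powr (1 / q) = C powr (1 / q) * S powr (1 / p)"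
        using q by (simp add: powr_mult powr_powr)
      moreover have "0 \<le> C * S powr (q / p)" using C by simp
      ultimately show ?thesis
        by (simp only: epowr_ennreal S(2) ennreal_mult powr_ge_zero)
    qed
    finally show "Lq_norm (ennreal q) circle_measure (variation r F)
        \<le> ennreal (C powr (1 / q)) * lp_norm (ennreal p) F"
      using q by (simp add: Lq_norm_def borel_measurable_variation)
  qed
qed

theorem proposition3p1:
  fixes p p' r :: ennreal
  assumes "1 \<le> p" "p < 2" and "p < r" "r \<le> \<infinity>"
    and "1 / p + 1 / p' = 1"
  shows "\<exists>C < \<infinity>. \<forall>F \<in> lp_disc p.
           Lq_norm p' circle_measure (variation r F) \<le> C * lp_norm p F"
proof (cases "p = 1")
  case True
  have "1 / p' = 0"
  proof -
    have "1 + 1 / p' = 1 + 0" using assms(5) True by simp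
    then show ?thesis by (simp only: ennreal_add_left_cancel) simp
  qed
  then have p': "p' = \<infinity>"
    by (simp add: ennreal_divide_eq_0_iff)
  have "Lq_norm p' circle_measure (variation r F) \<le> 1 * lp_norm p F" if "F \<in> lp_disc p" for F
    using that assms(3) True
    by (auto simp: p' Lq_norm_def borel_measurable_variation lp_disc_def space_circle_measure
        intro!: esssup_I AE_I2 variation_le_l1_norm)
  then show ?thesis
    by (intro exI[of _ 1]) auto
next
  case False
  obtain p0 where p0: "p = ennreal p0" "1 < p0" "p0 < 2"
  proof (cases p)
    case (real x)
    have "1 < p" using assms(1) False by (simp add: less_le)
    then show ?thesis
      using that[of x] real assms(2) by (simp add: ennreal_less_iff flip: ennreal_1 ennreal_numeral)
  qed (use assms(2) in auto)
  have inv_p: "1 / p = ennreal (1 / p0)"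
    using p0 by (simp add: divide_ennreal flip: ennreal_1)
  have "p' \<noteq> \<infinity>"
  proof
    assume "p' = \<infinity>"
    then have "ennreal (1 / p0) = ennreal 1"
      using assms(5) by (simp add: inv_p)
    then show False
      using p0 by (subst (asm) ennreal_inj) auto
  qed
  moreover have "p' \<noteq> 0"
    using assms(5) by auto
  ultimately obtain q where q: "p' = ennreal q" "0 < q"
    by (cases p') (auto simp: less_le)
  have pq: "1 / p0 + 1 / q = 1"
  proof -
    have "ennreal (1 / p0 + 1 / q) = ennreal (1 / p0) + ennreal (1 / q)"
      using p0 q by (intro ennreal_plus) auto
    also have "ennreal (1 / q) = 1 / p'"
      using q by (simp add: divide_ennreal flip: ennreal_1)
    finally have "ennreal (1 / p0 + 1 / q) = ennreal 1"
      using assms(5) by (simp add: inv_p)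
    then show ?thesis
      using p0 q by (subst (asm) ennreal_inj) auto
  qed
  \<comment> \<open>The exponent \<open>s = min r 2\<close> works: \<open>r\<close> itself may exceed \<open>q\<close> or be infinite.\<close>
  obtain s where s: "p0 < s" "s \<le> q" "ennreal s \<le> r"
  proof (cases "r \<le> 2")
    case True
    then obtain s where s: "r = ennreal s" "0 \<le> s" by (cases r) (auto simp: top_unique)
    have "s \<le> 2"
      using True s by (simp flip: ennreal_numeral)
    moreover have "p0 < s"
      using assms(3) s p0 by (simp add: ennreal_less_iff)
    ultimately show ?thesis
      using that[of s] s conjugate_exponent(2)[OF p0(2,3) pq] by simp
  next
    case False
    then show ?thesis
      using that[of 2] p0 conjugate_exponent(2)[OF p0(2,3) pq] by simp
  qed
  obtain C where "0 \<le> C" "\<And>F. lp_norm (ennreal p0) F < \<infinity> \<Longrightarrow>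
       Lq_norm (ennreal q) circle_measure (variation r F) \<le> ennreal C * lp_norm (ennreal p0) F"
    using variation_Lq_norm_le[OF p0(2,3) pq s] by blast
  then show ?thesis
    by (intro exI[of _ "ennreal C"]) (auto simp: p0 q lp_disc_def)
qed

end
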